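(* The $n$-dimensional commutative algebra $\mathbf{n}_2\oplus\mathbf{a}_{n-2}$ ($n\ge 2$) is of level one.
   Context: All algebras are finite-dimensional over $\mathbb{C}$. $\mathbf{a}_m$ denotes the $m$-dimensional algebra with zero multiplication, and $\mathbf{n}_2$ the two-dimensional algebra with basis $e_1,e_2$ and only nonzero product $[e_1,e_1]=e_2$. A (right) Leibniz algebra is a vector space $L$ with a bilinear bracket satisfying $[x,[y,z]]=[[x,y],z]-[[x,z],y]$; $\mathbf{n}_2\oplus\mathbf{a}_{n-2}$ is a Leibniz algebra. $\mathrm{GL}_n(\mathbb{C})$ acts on bilinear multiplications on $V=\mathbb{C}^n$ by $(g*\lambda)(x,y)=g(\lambda(g^{-1}x,g^{-1}y))$; orbits $\mathrm{Orb}(\lambda)$ are isomorphism classes. $\lambda\rightarrow\mu$ ($\lambda$ degenerates to $\mu$) means that $\mathrm{Orb}(\mu)$ lies in the Zariski closure of $\mathrm{Orb}(\lambda)$; it is nontrivial if $\lambda\not\cong\mu$. A (nontrivial) degeneration $\lambda\rightarrow\mu$ is direct if there is no chain of nontrivial degenerations $\lambda\rightarrow\nu\rightarrow\mu$. The level $\mathrm{lev}_n(\lambda)$ of an $n$-dimensional algebra $\lambda$ is the maximum length of a chain of direct degenerations starting at $\lambda$ and ending with $\mathbf{a}_n$. *)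

theory Defs
  imports "HOL-Analysis.Analysis"
begin

type_synonym 'n mult = "complex ^ 'n \<Rightarrow> complex ^ 'n \<Rightarrow> complex ^ 'n"

text \<open>The constant \<open>bilinear\<close> of the library means bilinear over the reals; here we need
  bilinearity over the complex numbers, with respect to the scaling \<open>*s\<close>.\<close>

definition bilinear_mults :: "'n::finite mult set" where
  "bilinear_mults = {\<phi>.
     (\<forall>x. Vector_Spaces.linear vector_scalar_mult vector_scalar_mult (\<lambda>y. \<phi> x y)) \<and>
     (\<forall>y. Vector_Spaces.linear vector_scalar_mult vector_scalar_mult (\<lambda>x. \<phi> x y))}"

definition commutative_mult :: "'n::finite mult \<Rightarrow> bool" where
  "commutative_mult \<phi> \<longleftrightarrow> (\<forall>x y. \<phi> x y = \<phi> y x)"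

definition gl_action :: "complex ^ 'n ^ 'n \<Rightarrow> 'n::finite mult \<Rightarrow> 'n mult" where
  "gl_action g \<phi> = (\<lambda>x y. g *v \<phi> (matrix_inv g *v x) (matrix_inv g *v y))"

definition Orb :: "'n::finite mult \<Rightarrow> 'n mult set" where
  "Orb \<phi> = {gl_action g \<phi> | g. invertible g}"

definition isomorphic_mult :: "'n::finite mult \<Rightarrow> 'n mult \<Rightarrow> bool" where
  "isomorphic_mult \<phi> \<mu> \<longleftrightarrow> \<mu> \<in> Orb \<phi>"

text \<open>The polynomial functions in the structure constants of a multiplication, that is, in its
  coordinates with respect to the basis of the affine space of all bilinear multiplications that
  comes from the standard basis of \<open>complex ^ 'n\<close>.\<close>

inductive_set polynomial_functions :: "('n::finite mult \<Rightarrow> complex) set" where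
  const: "(\<lambda>_. c) \<in> polynomial_functions"
| structure_constant: "(\<lambda>\<phi>. \<phi> (axis i 1) (axis j 1) $ k) \<in> polynomial_functions"
| add: "p \<in> polynomial_functions \<Longrightarrow> q \<in> polynomial_functions \<Longrightarrow>
    (\<lambda>\<phi>. p \<phi> + q \<phi>) \<in> polynomial_functions"
| mult: "p \<in> polynomial_functions \<Longrightarrow> q \<in> polynomial_functions \<Longrightarrow>
    (\<lambda>\<phi>. p \<phi> * q \<phi>) \<in> polynomial_functions"

definition zariski_closed :: "'n::finite mult set \<Rightarrow> bool" where
  "zariski_closed A \<longleftrightarrow>
     (\<exists>P \<subseteq> polynomial_functions. A = {\<phi> \<in> bilinear_mults. \<forall>p\<in>P. p \<phi> = 0})"

definition zariski_closure :: "'n::finite mult set \<Rightarrow> 'n mult set" where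
  "zariski_closure A = zariski_closed hull A"

definition degenerates :: "'n::finite mult \<Rightarrow> 'n mult \<Rightarrow> bool" where
  "degenerates \<phi> \<mu> \<longleftrightarrow> \<phi> \<in> bilinear_mults \<and> \<mu> \<in> bilinear_mults \<and>
     Orb \<mu> \<subseteq> zariski_closure (Orb \<phi>)"

definition nontriv_degenerates :: "'n::finite mult \<Rightarrow> 'n mult \<Rightarrow> bool" where
  "nontriv_degenerates \<phi> \<mu> \<longleftrightarrow> degenerates \<phi> \<mu> \<and> \<not> isomorphic_mult \<phi> \<mu>"

definition direct_degenerates :: "'n::finite mult \<Rightarrow> 'n mult \<Rightarrow> bool" where
  "direct_degenerates \<phi> \<mu> \<longleftrightarrow> nontriv_degenerates \<phi> \<mu> \<and>
     \<not> (\<exists>\<nu>. nontriv_degenerates \<phi> \<nu> \<and> nontriv_degenerates \<nu> \<mu>)"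

definition zero_mult :: "'n::finite mult" where
  "zero_mult = (\<lambda>x y. 0)"

text \<open>The length of a chain is its number of degeneration steps. On bilinear multiplications the
  set below is nonempty and finite (orbit dimensions strictly decrease along a chain), so that
  \<open>Max\<close> is a genuine maximum; \<open>Max\<close> of an empty or infinite set would be unspecified.\<close>

definition lev :: "'n::finite mult \<Rightarrow> nat" where
  "lev \<phi> = Max {m. (direct_degenerates ^^ m) \<phi> zero_mult}"

text \<open>The direct sum of the two-dimensional algebra \<open>[e\<^sub>1,e\<^sub>1] = e\<^sub>2\<close> and the
  algebra with zero multiplication on the remaining coordinates. The index type carries no order,
  so the distinct indices \<open>a\<close> and \<open>b\<close> of the basis vectors \<open>e\<^sub>1\<close> and
  \<open>e\<^sub>2\<close> are parameters.\<close>

definition n2_sum_abelian :: "'n::finite \<Rightarrow> 'n \<Rightarrow> 'n mult" where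
  "n2_sum_abelian a b = (\<lambda>x y. (x $ a * y $ a) *s axis b 1)"

lemma n2_sum_abelian_bilinear: "n2_sum_abelian a b \<in> bilinear_mults"
  unfolding bilinear_mults_def n2_sum_abelian_def Vector_Spaces.linear_iff
  by (auto simp: vec_eq_iff algebra_simps intro: vec.vector_space_axioms)

lemma n2_sum_abelian_axis:
  "n2_sum_abelian a b (axis i 1) (axis j 1) = (if i = a \<and> j = a then axis b 1 else 0)"
  by (auto simp: n2_sum_abelian_def vec_eq_iff axis_def)

end

theory Submission
  imports Defs
begin

text \<open>
  For vectors \<open>w\<close> and \<open>v\<close>, let \<open>square_mult w v\<close> be the multiplication
  \<open>(x, y) \<mapsto> (w \<cdot> x) (w \<cdot> y) v\<close>. The algebra under study is the case where
  \<open>w\<close> and \<open>v\<close> are two distinct unit vectors, and everything rests on two facts.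

  Its orbit consists of all \<open>square_mult w v\<close> with \<open>w\<close>, \<open>v\<close> nonzero and
  \<open>w \<cdot> v = 0\<close> (\<open>Orb_n2_sum_abelian\<close>): the linear group acts transitively on pairs
  of a nonzero covector and a nonzero vector that it annihilates.

  The Zariski closure of the orbit adds only the zero multiplication
  (\<open>zariski_closure_Orb_n2_sum_abelian\<close>). The structure constants
  \<open>w\<^sub>i w\<^sub>j v\<^sub>k\<close> of the orbit satisfy quadratic equations: those of a decomposable
  tensor with its first two factors equal, and those that express
  \<open>(x y) z = 0\<close>. A nonzero solution of these equations is again of the form
  \<open>square_mult w v\<close> with \<open>w \<cdot> v = 0\<close>
  (\<open>square_mult_if_structure_constants\<close>). Conversely all nonzero multiples of the
  multiplication lie in its orbit, and a polynomial that vanishes on a punctured line through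
  the origin vanishes at the origin.

  So the zero multiplication is the only nontrivial degeneration, and it has none of its own.
  Every chain of direct degenerations down to zero therefore has exactly one step.
\<close>

section \<open>Bilinear multiplications\<close>

lemma linear_eq_if_eq_on_axes:
  fixes f g :: "complex ^ 'n::finite \<Rightarrow> complex ^ 'm::finite"
  assumes "Vector_Spaces.linear vector_scalar_mult vector_scalar_mult f"
    and "Vector_Spaces.linear vector_scalar_mult vector_scalar_mult g"
    and "\<And>i. f (axis i 1) = g (axis i 1)"
  shows "f = g"
proof
  fix x
  have "f x = matrix f *v x" "g x = matrix g *v x"
    using matrix_works[OF assms(1)] matrix_works[OF assms(2)] by simp_all
  moreover have "matrix f = matrix g"
    by (simp add: matrix_def assms(3))
  ultimately show "f x = g x" by simp
qed

lemma bilinear_mults_eqI: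
  assumes "\<phi> \<in> bilinear_mults" "\<psi> \<in> bilinear_mults"
    and "\<And>i j k. \<phi> (axis i 1) (axis j 1) $ k = \<psi> (axis i 1) (axis j 1) $ k"
  shows "\<phi> = \<psi>"
proof -
  have "\<phi> (axis i 1) = \<psi> (axis i 1)" for i
    using assms by (intro linear_eq_if_eq_on_axes) (auto simp: bilinear_mults_def vec_eq_iff)
  then have "(\<lambda>x. \<phi> x y) = (\<lambda>x. \<psi> x y)" for y
    using assms by (intro linear_eq_if_eq_on_axes) (auto simp: bilinear_mults_def)
  then show ?thesis by (metis ext)
qed

lemma zero_mult_bilinear: "zero_mult \<in> bilinear_mults"
  by (auto simp: bilinear_mults_def zero_mult_def Vector_Spaces.linear_iff
      intro: vec.vector_space_axioms)

lemma matrix_inv_left: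
  fixes g :: "complex ^ 'n::finite ^ 'n"
  assumes "invertible g"
  shows "matrix_inv g ** g = mat 1"
  using someI_ex[OF assms[unfolded invertible_def]] by (simp add: matrix_inv_def)

lemma Orb_refl:
  fixes \<phi> :: "'n::finite mult"
  shows "\<phi> \<in> Orb \<phi>"
proof -
  have "invertible (mat 1 :: complex ^ 'n ^ 'n)"
    by (auto simp: invertible_def)
  moreover from this have "matrix_inv (mat 1 :: complex ^ 'n ^ 'n) = mat 1"
    using matrix_inv_left[of "mat 1 :: complex ^ 'n ^ 'n"] by simp
  then have "gl_action (mat 1) \<phi> = \<phi>" by (simp add: gl_action_def)
  ultimately show ?thesis unfolding Orb_def by force
qed

lemma Orb_zero_mult: "Orb zero_mult = {zero_mult}"
proof
  show "Orb zero_mult \<subseteq> {zero_mult}"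
    by (auto simp: Orb_def gl_action_def zero_mult_def)
  show "{zero_mult} \<subseteq> Orb zero_mult" by (simp add: Orb_refl)
qed

section \<open>Polynomial functions and the Zariski closure\<close>

lemma polynomial_functions_diff:
  assumes "p \<in> polynomial_functions" "q \<in> polynomial_functions"
  shows "(\<lambda>\<phi>. p \<phi> - q \<phi>) \<in> polynomial_functions"
  using polynomial_functions.add[OF assms(1)
      polynomial_functions.mult[OF polynomial_functions.const[of "-1"] assms(2)]]
  by simp

lemma polynomial_functions_sum:
  assumes "finite A" "\<And>i. i \<in> A \<Longrightarrow> p i \<in> polynomial_functions"
  shows "(\<lambda>\<phi>. \<Sum>i\<in>A. p i \<phi>) \<in> polynomial_functions"
  using assms
  by (induction A) (auto intro: polynomial_functions.const polynomial_functions.add)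

text \<open>Closed sets are given by arbitrary systems of equations, so the closure is cut out by
  the largest system available: all polynomial functions that vanish on the set.\<close>

lemma in_zariski_closure_iff:
  assumes "A \<subseteq> bilinear_mults"
  shows "\<phi> \<in> zariski_closure A \<longleftrightarrow> \<phi> \<in> bilinear_mults \<and>
    (\<forall>p \<in> polynomial_functions. (\<forall>\<psi>\<in>A. p \<psi> = 0) \<longrightarrow> p \<phi> = 0)" (is "_ \<longleftrightarrow> ?R")
proof
  let ?P = "{p \<in> polynomial_functions. \<forall>\<psi>\<in>A. p \<psi> = 0}"
  let ?Z = "{\<phi> \<in> bilinear_mults. \<forall>p\<in>?P. p \<phi> = 0}"
  assume "\<phi> \<in> zariski_closure A"
  moreover have "zariski_closed ?Z"
    unfolding zariski_closed_def by (rule exI[of _ ?P]) auto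
  moreover have "A \<subseteq> ?Z" using assms by auto
  ultimately have "\<phi> \<in> ?Z"
    unfolding zariski_closure_def using hull_minimal[of A ?Z zariski_closed] by blast
  then show ?R by blast
next
  assume R: ?R
  show "\<phi> \<in> zariski_closure A"
    unfolding zariski_closure_def hull_def
  proof clarify
    fix T :: "'a mult set"
    assume "zariski_closed T" "A \<subseteq> T"
    then obtain P where "P \<subseteq> polynomial_functions" "T = {\<phi> \<in> bilinear_mults. \<forall>p\<in>P. p \<phi> = 0}"
      unfolding zariski_closed_def by blast
    then show "\<phi> \<in> T" using R \<open>A \<subseteq> T\<close> by blast
  qed
qed

lemma zariski_closure_zero_mult: "zariski_closure {zero_mult :: 'n::finite mult} = {zero_mult}"
proof -
  have "\<mu> = zero_mult" if "\<mu> \<in> zariski_closure {zero_mult}" for \<mu> :: "'n mult"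
  proof (rule bilinear_mults_eqI)
    have mu: "\<mu> \<in> bilinear_mults"
      and vanish: "\<And>p. \<lbrakk>p \<in> polynomial_functions; p zero_mult = 0\<rbrakk> \<Longrightarrow> p \<mu> = 0"
      using that in_zariski_closure_iff[of "{zero_mult}" \<mu>] zero_mult_bilinear by auto
    show "\<mu> \<in> bilinear_mults" by (rule mu)
    fix i j k
    show "\<mu> (axis i 1) (axis j 1) $ k = zero_mult (axis i 1) (axis j 1) $ k"
      using vanish[OF polynomial_functions.structure_constant[of i j k]]
      by (simp add: zero_mult_def)
  qed (rule zero_mult_bilinear)
  moreover have "zero_mult \<in> zariski_closure {zero_mult :: 'n mult}"
    by (simp add: zariski_closure_def hull_inc)
  ultimately show ?thesis by blast
qed

lemma polynomial_function_on_line: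
  assumes "p \<in> polynomial_functions"
  shows "\<exists>P. \<forall>s. p (\<lambda>x y. s *s \<phi> x y) = poly P s"
  using assms
proof induction
  case (const c)
  show ?case by (rule exI[of _ "[:c:]"]) simp
next
  case (structure_constant i j k)
  show ?case
    by (rule exI[of _ "[:0, \<phi> (axis i 1) (axis j 1) $ k:]"]) simp
next
  case (add p q)
  then show ?case by (metis poly_add)
next
  case (mult p q)
  then show ?case by (metis poly_mult)
qed

text \<open>On the line through \<open>\<phi>\<close> and the origin a polynomial function is a polynomial
  in one variable. If it vanishes off the origin, it has infinitely many roots.\<close>

lemma zero_mult_in_zariski_closure:
  assumes "A \<subseteq> bilinear_mults" "\<And>s. s \<noteq> 0 \<Longrightarrow> (\<lambda>x y. s *s \<phi> x y) \<in> A"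
  shows "zero_mult \<in> zariski_closure A"
proof -
  have "p zero_mult = 0" if p: "p \<in> polynomial_functions" and z: "\<forall>\<psi>\<in>A. p \<psi> = 0" for p
  proof -
    obtain P where P: "\<And>s. p (\<lambda>x y. s *s \<phi> x y) = poly P s"
      using polynomial_function_on_line[OF p] by blast
    have "UNIV - {0} \<subseteq> {s. poly P s = 0}" using z assms(2) P[symmetric] by auto
    moreover have "infinite (UNIV - {0::complex})"
      by (simp add: infinite_UNIV_char_0)
    ultimately have "P = 0" using poly_roots_finite infinite_super by blast
    then show ?thesis using P[of 0] by (simp add: zero_mult_def)
  qed
  then show ?thesis
    using in_zariski_closure_iff[OF assms(1)] zero_mult_bilinear by blast
qed

section \<open>The orbit of the algebra and its closure\<close>

text \<open>The pairing is complex bilinear, unlike the real-valued inner product on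
  \<open>complex ^ 'n\<close>. A covector is given by its row \<open>w\<close> of coefficients, so that the rows
  of a matrix are covectors.\<close>

definition pairing :: "complex ^ 'n::finite \<Rightarrow> complex ^ 'n \<Rightarrow> complex" where
  "pairing w x = (\<Sum>i\<in>UNIV. w $ i * x $ i)"

definition square_mult :: "complex ^ 'n::finite \<Rightarrow> complex ^ 'n \<Rightarrow> 'n mult" where
  "square_mult w v = (\<lambda>x y. (pairing w x * pairing w y) *s v)"

lemma pairing_axis_left [simp]: "pairing (axis i 1) x = x $ i"
  by (simp add: pairing_def axis_def if_distrib if_distribR cong: if_cong)

lemma pairing_axis_right [simp]: "pairing w (axis i 1) = w $ i"
  by (simp add: pairing_def axis_def if_distrib if_distribR cong: if_cong)

lemma pairing_add: "pairing w (x + y) = pairing w x + pairing w y"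
  by (simp add: pairing_def algebra_simps sum.distrib)

lemma pairing_scale: "pairing w (c *s x) = c * pairing w x"
  by (simp add: pairing_def algebra_simps sum_distrib_left)

lemma square_mult_axis: "square_mult w v (axis i 1) (axis j 1) $ k = w $ i * w $ j * v $ k"
  by (simp add: square_mult_def)

lemma square_mult_bilinear: "square_mult w v \<in> bilinear_mults"
  unfolding bilinear_mults_def square_mult_def Vector_Spaces.linear_iff
  by (auto simp: vec_eq_iff pairing_add pairing_scale algebra_simps
      intro: vec.vector_space_axioms)

lemma n2_sum_abelian_eq_square_mult:
  "n2_sum_abelian a b = square_mult (axis a 1) (axis b 1)"
  by (simp add: n2_sum_abelian_def square_mult_def)

text \<open>The coordinate \<open>a\<close> of \<open>g\<^sup>-\<^sup>1 x\<close> is the pairing of \<open>x\<close> with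
  row \<open>a\<close> of \<open>g\<^sup>-\<^sup>1\<close>. An element of the orbit thus records only this row and
  the column \<open>b\<close> of \<open>g\<close>.\<close>

lemma gl_action_n2_sum_abelian:
  "gl_action g (n2_sum_abelian a b) = square_mult (matrix_inv g $ a) (g *v axis b 1)"
  by (simp add: gl_action_def n2_sum_abelian_def square_mult_def vec.scale
      matrix_vector_mult_def[of "matrix_inv g"] pairing_def)

lemma exists_bij_two_points:
  assumes "a \<noteq> b" "p \<noteq> r"
  obtains \<sigma> :: "'a \<Rightarrow> 'a" where "bij \<sigma>" "\<sigma> a = p" "\<sigma> b = r"
proof
  let ?\<tau> = "Transposition.transpose a p"
  let ?\<sigma> = "Transposition.transpose (?\<tau> b) r \<circ> ?\<tau>"
  show "bij ?\<sigma>" by (intro bij_comp bij_transpose)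
  show "?\<sigma> b = r" by simp
  have "?\<tau> b \<noteq> p" using assms(1) by (auto simp: Transposition.transpose_def)
  then show "?\<sigma> a = p" using assms(2) by (simp add: Transposition.transpose_def)
qed

text \<open>By the previous formula it suffices to find an invertible \<open>h = g\<^sup>-\<^sup>1\<close> with
  row \<open>a\<close> equal to \<open>w\<close> that sends \<open>v\<close> to the unit vector \<open>b\<close>.
  Coordinate \<open>b\<close> of \<open>h x\<close> is scaled to be \<open>1\<close> at \<open>v\<close>; every other
  coordinate except \<open>a\<close> is corrected by a multiple of \<open>x\<^sub>r\<close> so as to vanish at
  \<open>v\<close>.\<close>

lemma square_mult_in_Orb:
  assumes "a \<noteq> b" "w \<noteq> 0" "v \<noteq> 0" "pairing w v = 0"
  shows "square_mult w v \<in> Orb (n2_sum_abelian a b)"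
proof -
  obtain p r where p: "w $ p \<noteq> 0" and r: "v $ r \<noteq> 0" and pr: "p \<noteq> r"
  proof -
    obtain p where p: "w $ p \<noteq> 0" using assms(2) by (auto simp: vec_eq_iff)
    \<comment> \<open>If \<open>v\<close> were a multiple of the unit vector \<open>p\<close>, it would not pair to zero with \<open>w\<close>.\<close>
    have "\<exists>r. r \<noteq> p \<and> v $ r \<noteq> 0"
    proof (rule ccontr)
      assume none: "\<not> ?thesis"
      then have "v = (v $ p) *s axis p 1" by (auto simp: vec_eq_iff axis_def)
      then have "v $ p * w $ p = 0" using assms(4) by (metis pairing_scale pairing_axis_right)
      then show False using none assms(3) p by (auto simp: vec_eq_iff)
    qed
    then show ?thesis using that p by blast
  qed
  \<comment> \<open>The relabelling moves the pivots \<open>p\<close>, \<open>r\<close> of \<open>w\<close>, \<open>v\<close> to the positions \<open>a\<close>, \<open>b\<close>.\<close>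
  obtain \<sigma> where \<sigma>: "bij \<sigma>" "\<sigma> a = p" "\<sigma> b = r"
    using exists_bij_two_points[OF assms(1) pr] .
  define h :: "complex ^ 'a \<Rightarrow> complex ^ 'a" where
    "h x = (\<chi> j. if j = a then pairing w x else if j = b then x $ r / v $ r
       else x $ \<sigma> j - x $ r * (v $ \<sigma> j / v $ r))" for x
  have lin: "Vector_Spaces.linear vector_scalar_mult vector_scalar_mult h"
    unfolding Vector_Spaces.linear_iff h_def
    by (auto simp: vec_eq_iff pairing_add pairing_scale algebra_simps add_divide_distrib
        intro: vec.vector_space_axioms)
  have h_mat: "matrix h *v x = h x" for x by (rule matrix_works[OF lin])
  have "x = 0" if "h x = 0" for x
  proof -
    have eqs: "h x $ j = 0" for j using that by simp
    have xr: "x $ r = 0" using eqs[of b] assms(1) r by (simp add: h_def)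
    have "x $ i = 0" if "i \<noteq> p" for i
    proof -
      obtain j where j: "i = \<sigma> j" using \<sigma>(1) by (metis bij_pointE)
      show ?thesis using eqs[of j] j that \<sigma>(2,3) xr by (auto simp: h_def split: if_splits)
    qed
    then have "x = (x $ p) *s axis p 1" by (auto simp: vec_eq_iff axis_def)
    moreover from this have "pairing w x = x $ p * w $ p"
      by (metis pairing_scale pairing_axis_right)
    ultimately show ?thesis using eqs[of a] p by (simp add: h_def)
  qed
  then obtain g where left: "g ** matrix h = mat 1"
    using matrix_left_invertible_ker[of "matrix h"] h_mat by metis
  then have right: "matrix h ** g = mat 1" by (simp add: matrix_left_right_inverse)
  have inv: "invertible g" unfolding invertible_def using left right by blast
  have inv_g: "matrix_inv g = matrix h"
    using left right matrix_inv_left[OF inv] by (metis matrix_mul_assoc matrix_mul_lid matrix_mul_rid)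
  have "h v = axis b 1"
  proof -
    have "h v $ j = axis b 1 $ j" for j
      using assms(1,4) r by (simp add: h_def axis_def)
    then show ?thesis by (simp add: vec_eq_iff)
  qed
  then have "g *v axis b 1 = v"
    using left h_mat by (metis matrix_vector_mul_assoc matrix_vector_mul_lid)
  moreover have "matrix_inv g $ a = w"
    by (simp add: inv_g matrix_def h_def vec_eq_iff)
  ultimately show ?thesis
    using inv gl_action_n2_sum_abelian[of g a b] unfolding Orb_def by force
qed

lemma Orb_n2_sum_abelian:
  assumes "a \<noteq> b"
  shows "Orb (n2_sum_abelian a b) = {square_mult w v |w v. w \<noteq> 0 \<and> v \<noteq> 0 \<and> pairing w v = 0}"
proof (intro equalityI subsetI)
  fix \<phi> assume "\<phi> \<in> Orb (n2_sum_abelian a b)"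
  then obtain g where g: "invertible g" and \<phi>: "\<phi> = gl_action g (n2_sum_abelian a b)"
    unfolding Orb_def by auto
  let ?w = "matrix_inv g $ a" and ?v = "g *v axis b 1"
  have row: "pairing ?w (g *v x) = x $ a" for x
  proof -
    have "pairing ?w (g *v x) = (matrix_inv g *v (g *v x)) $ a"
      by (simp add: pairing_def matrix_vector_mult_def)
    also have "\<dots> = x $ a" by (simp add: matrix_vector_mul_assoc matrix_inv_left[OF g])
    finally show ?thesis .
  qed
  have "?w \<noteq> 0" using row[of "axis a 1"] by (auto simp: pairing_def)
  moreover have "?v \<noteq> 0"
  proof
    assume "?v = 0"
    then have "matrix_inv g *v (g *v axis b 1) = 0" by simp
    then show False by (simp add: matrix_vector_mul_assoc matrix_inv_left[OF g] axis_eq_0_iff)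
  qed
  moreover have "pairing ?w ?v = 0" using row[of "axis b 1"] assms by (simp add: axis_def)
  ultimately show "\<phi> \<in> {square_mult w v |w v. w \<noteq> 0 \<and> v \<noteq> 0 \<and> pairing w v = 0}"
    using \<phi> gl_action_n2_sum_abelian by blast
qed (use square_mult_in_Orb[OF assms] in auto)

text \<open>The first two families of equations allow moving indices between the two factors
  of a product of structure constants. Through them a nonzero constant yields a nonzero
  constant \<open>c\<^sub>p\<^sub>p\<^sub>r\<close> on the diagonal, and every constant is then determined by the
  \<open>c\<^sub>i\<^sub>p\<^sub>r\<close> and the \<open>c\<^sub>p\<^sub>p\<^sub>k\<close>: \<open>v\<close> is the square of the unit vector \<open>p\<close>,
  and \<open>w\<close> is the coordinate \<open>r\<close> of right multiplication by it, normalized to be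
  \<open>1\<close> at \<open>p\<close>. The third family says that all products of three elements
  bracketed to the left vanish, which for this \<open>w\<close> and \<open>v\<close> means
  \<open>w \<cdot> v = 0\<close>.\<close>

lemma square_mult_if_structure_constants:
  assumes "\<phi> \<in> bilinear_mults" "\<phi> \<noteq> zero_mult"
    and swap_factors: "\<And>i j k l m r. \<phi> (axis i 1) (axis j 1) $ k * \<phi> (axis l 1) (axis m 1) $ r
        = \<phi> (axis i 1) (axis l 1) $ k * \<phi> (axis j 1) (axis m 1) $ r"
    and swap_values: "\<And>i j k l m r. \<phi> (axis i 1) (axis j 1) $ k * \<phi> (axis l 1) (axis m 1) $ r
        = \<phi> (axis i 1) (axis j 1) $ r * \<phi> (axis l 1) (axis m 1) $ k"
    and nil: "\<And>i j l r. (\<Sum>k\<in>UNIV. \<phi> (axis i 1) (axis j 1) $ k * \<phi> (axis k 1) (axis l 1) $ r) = 0"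
  obtains w v where "w \<noteq> 0" "v \<noteq> 0" "pairing w v = 0" "\<phi> = square_mult w v"
proof -
  define c where "c i j k = \<phi> (axis i 1) (axis j 1) $ k" for i j k
  note swaps = swap_factors[folded c_def] swap_values[folded c_def]
  obtain p q r where "c p q r \<noteq> 0"
  proof -
    have "\<exists>p q r. c p q r \<noteq> 0"
    proof (rule ccontr)
      assume "\<not> ?thesis"
      then have "\<phi> = zero_mult"
        by (intro bilinear_mults_eqI assms zero_mult_bilinear) (simp add: c_def zero_mult_def)
      then show False using assms(2) by blast
    qed
    then show ?thesis using that by blast
  qed
  then have nz: "c p p r \<noteq> 0" using swaps(1)[of p q r p q r] by auto
  define w where "w = (\<chi> i. c i p r / c p p r)"
  define v where "v = \<phi> (axis p 1) (axis p 1)"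
  have v: "v $ k = c p p k" for k by (simp add: v_def c_def)
  have "w $ p = 1" using nz by (simp add: w_def)
  then have "w \<noteq> 0" by auto
  moreover have "v \<noteq> 0" using nz v[of r] by auto
  moreover have "pairing w v = 0"
  proof -
    have "pairing w v = (\<Sum>k\<in>UNIV. c p p k * c k p r) / c p p r"
      by (simp add: pairing_def w_def v sum_divide_distrib mult.commute)
    then show ?thesis using nil[folded c_def, of p p p r] by simp
  qed
  moreover have "\<phi> = square_mult w v"
  proof (rule bilinear_mults_eqI)
    fix i j k
    have "c i j k * c p p r * c p p r = c j p r * (c i p k * c p p r)"
      using swaps(1)[of i j k p p r] by simp
    also have "\<dots> = c i p r * c j p r * c p p k"
      using swaps(2)[of i p k p p r] by simp
    finally show "\<phi> (axis i 1) (axis j 1) $ k = square_mult w v (axis i 1) (axis j 1) $ k"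
      using nz by (simp add: square_mult_axis v w_def flip: c_def) (simp add: field_simps)
  qed (use assms square_mult_bilinear in auto)
  ultimately show ?thesis by (rule that)
qed

lemma zariski_closure_Orb_n2_sum_abelian:
  assumes "a \<noteq> b"
  shows "zariski_closure (Orb (n2_sum_abelian a b)) = insert zero_mult (Orb (n2_sum_abelian a b))"
    (is "zariski_closure ?O = _")
proof
  have sub: "?O \<subseteq> bilinear_mults"
    by (auto simp: Orb_n2_sum_abelian[OF assms] square_mult_bilinear)
  have "(\<lambda>x y. s *s n2_sum_abelian a b x y) \<in> ?O" if "s \<noteq> 0" for s
  proof -
    have "(\<lambda>x y. s *s n2_sum_abelian a b x y) = square_mult (axis a 1) (s *s axis b 1)"
      by (simp add: n2_sum_abelian_def square_mult_def mult.commute)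
    also have "\<dots> \<in> ?O"
      using that assms
      by (intro square_mult_in_Orb)
        (simp_all add: pairing_scale axis_eq_0_iff, simp add: axis_def)
    finally show ?thesis .
  qed
  then show "insert zero_mult ?O \<subseteq> zariski_closure ?O"
    using zero_mult_in_zariski_closure[OF sub] hull_subset[of ?O zariski_closed]
    by (auto simp: zariski_closure_def)
  show "zariski_closure ?O \<subseteq> insert zero_mult ?O"
  proof
    fix \<mu> assume \<mu>: "\<mu> \<in> zariski_closure ?O"
    then have bil: "\<mu> \<in> bilinear_mults" using in_zariski_closure_iff[OF sub] by blast
    have vanish: "p \<mu> = 0"
      if "p \<in> polynomial_functions" "\<And>w v. pairing w v = 0 \<Longrightarrow> p (square_mult w v) = 0" for p
    proof -
      have "\<forall>\<psi>\<in>?O. p \<psi> = 0" using that(2) by (auto simp: Orb_n2_sum_abelian[OF assms])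
      then show ?thesis using that(1) \<mu> in_zariski_closure_iff[OF sub] by blast
    qed
    note poly_intros = polynomial_functions_diff polynomial_functions_sum
      polynomial_functions.mult polynomial_functions.structure_constant finite
    show "\<mu> \<in> insert zero_mult ?O"
    proof (cases "\<mu> = zero_mult")
      case False
      obtain w v where "w \<noteq> 0" "v \<noteq> 0" "pairing w v = 0" "\<mu> = square_mult w v"
      proof (rule square_mult_if_structure_constants[OF bil False])
        fix i j k l m r
        show "\<mu> (axis i 1) (axis j 1) $ k * \<mu> (axis l 1) (axis m 1) $ r
            = \<mu> (axis i 1) (axis l 1) $ k * \<mu> (axis j 1) (axis m 1) $ r"
          using vanish[of "\<lambda>\<mu>. \<mu> (axis i 1) (axis j 1) $ k * \<mu> (axis l 1) (axis m 1) $ r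
            - \<mu> (axis i 1) (axis l 1) $ k * \<mu> (axis j 1) (axis m 1) $ r"]
          by (force intro: poly_intros simp: square_mult_axis)
        show "\<mu> (axis i 1) (axis j 1) $ k * \<mu> (axis l 1) (axis m 1) $ r
            = \<mu> (axis i 1) (axis j 1) $ r * \<mu> (axis l 1) (axis m 1) $ k"
          using vanish[of "\<lambda>\<mu>. \<mu> (axis i 1) (axis j 1) $ k * \<mu> (axis l 1) (axis m 1) $ r
            - \<mu> (axis i 1) (axis j 1) $ r * \<mu> (axis l 1) (axis m 1) $ k"]
          by (force intro: poly_intros simp: square_mult_axis)
      next
        fix i j l r
        show "(\<Sum>k\<in>UNIV. \<mu> (axis i 1) (axis j 1) $ k * \<mu> (axis k 1) (axis l 1) $ r) = 0"
        proof (rule vanish)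
          fix w v :: "complex ^ 'a" assume "pairing w v = 0"
          have "(\<Sum>k\<in>UNIV. square_mult w v (axis i 1) (axis j 1) $ k
              * square_mult w v (axis k 1) (axis l 1) $ r)
            = w $ i * w $ j * w $ l * v $ r * pairing w v"
            by (simp add: square_mult_axis pairing_def sum_distrib_left mult_ac)
          then show "(\<Sum>k\<in>UNIV. square_mult w v (axis i 1) (axis j 1) $ k
              * square_mult w v (axis k 1) (axis l 1) $ r) = 0"
            using \<open>pairing w v = 0\<close> by simp
        qed (intro poly_intros)
      qed
      then show ?thesis using square_mult_in_Orb[OF assms] by blast
    qed simp
  qed
qed

section \<open>The level\<close>

theorem theorem3p14:
  fixes a b :: "'n::finite"
  assumes "CARD('n) \<ge> 2" and "a \<noteq> b"
  shows "commutative_mult (n2_sum_abelian a b) \<and> lev (n2_sum_abelian a b) = 1"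
proof
  let ?N = "n2_sum_abelian a b"
  show "commutative_mult ?N"
    by (simp add: commutative_mult_def n2_sum_abelian_def mult.commute)
  have "?N (axis a 1) (axis a 1) \<noteq> zero_mult (axis a 1) (axis a 1)"
    by (simp add: n2_sum_abelian_axis zero_mult_def axis_eq_0_iff)
  then have nz: "?N \<noteq> zero_mult" by metis
  have from_N: "\<nu> = zero_mult" if "nontriv_degenerates ?N \<nu>" for \<nu>
  proof -
    have "\<nu> \<in> zariski_closure (Orb ?N)" "\<nu> \<notin> Orb ?N"
      using that Orb_refl[of \<nu>]
      by (auto simp: nontriv_degenerates_def degenerates_def isomorphic_mult_def)
    then show ?thesis
      using zariski_closure_Orb_n2_sum_abelian[OF assms(2)] by blast
  qed
  have from_zero: "\<not> nontriv_degenerates zero_mult \<nu>" for \<nu> :: "'n mult"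
    using Orb_refl[of \<nu>]
    by (auto simp: nontriv_degenerates_def degenerates_def isomorphic_mult_def
        Orb_zero_mult zariski_closure_zero_mult)
  have "zero_mult \<notin> Orb ?N"
  proof
    assume "zero_mult \<in> Orb ?N"
    then obtain w v :: "complex ^ 'n" where wv: "w \<noteq> 0" "v \<noteq> 0" and eq: "zero_mult = square_mult w v"
      by (auto simp: Orb_n2_sum_abelian[OF assms(2)])
    obtain i k where "w $ i \<noteq> 0" "v $ k \<noteq> 0" using wv by (auto simp: vec_eq_iff)
    moreover have "zero_mult (axis i 1) (axis i 1) $ k = w $ i * w $ i * v $ k"
      by (simp only: eq square_mult_axis)
    ultimately show False by (simp add: zero_mult_def)
  qed
  then have "nontriv_degenerates ?N zero_mult"
    by (auto simp: nontriv_degenerates_def degenerates_def isomorphic_mult_def Orb_zero_mult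
        zariski_closure_Orb_n2_sum_abelian[OF assms(2)] n2_sum_abelian_bilinear zero_mult_bilinear)
  then have direct: "direct_degenerates ?N zero_mult"
    using from_N from_zero by (auto simp: direct_degenerates_def)
  have "m = 1" if chain: "(direct_degenerates ^^ m) ?N zero_mult" for m
  proof (cases m)
    case 0
    then show ?thesis using chain nz by simp
  next
    case (Suc n)
    then obtain \<nu> where "direct_degenerates ?N \<nu>" and rest: "(direct_degenerates ^^ n) \<nu> zero_mult"
      using relpowp_Suc_D2[of n direct_degenerates ?N zero_mult] chain by blast
    then have "\<nu> = zero_mult" using from_N by (simp add: direct_degenerates_def)
    have "n = 0"
    proof (rule ccontr)
      assume "n \<noteq> 0"
      then obtain k where "n = Suc k" by (cases n) auto
      then obtain \<kappa> where "direct_degenerates \<nu> \<kappa>"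
        using relpowp_Suc_D2[of k direct_degenerates \<nu> zero_mult] rest by blast
      then show False
        using \<open>\<nu> = zero_mult\<close> from_zero by (simp add: direct_degenerates_def)
    qed
    then show ?thesis using Suc by simp
  qed
  then have "{m. (direct_degenerates ^^ m) ?N zero_mult} = {1}"
    using direct by (auto simp: relpowp_1)
  then show "lev ?N = 1" by (simp add: lev_def)
qed

end
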